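(* For integers $j,k\geq 1$, let $W_{j,k}$ denote the number of weakly flattened Fubini rankings of length $j$ with runs of weak ascents having exactly $k$ runs of weak ascents, and let $S_{j,k}$ denote the number of flattened Fubini rankings of length $j$ with runs of weak ascents having exactly $k$ runs of weak ascents. Then for all integers $j,k\ge 1$: $$W_{j,k}=0 \iff k>\left\lceil \tfrac{j}{2}\right\rceil,\qquad\text{and likewise}\qquad S_{j,k}=0\iff k>\left\lceil \tfrac{j}{2}\right\rceil.$$
   Context: Let $[n]=\{1,2,\ldots,n\}$. A Fubini ranking of length $n$ is a tuple $r=(r_1,\ldots,r_n)\in[n]^n$ that records a valid ranking of $n$ competitors with ties allowed, where if exactly $k$ competitors are tied at rank $i$, then the next $k-1$ ranks $i+1,\ldots,i+k-1$ are disallowed; equivalently, $r_i=1+|\{j : r_j<r_i\}|$ for every $i\in[n]$. A run of weak ascents of a word $w=w_1\cdots w_n$ is a maximal contiguous subword $w_iw_{i+1}\cdots w_j$ with $w_l\le w_{l+1}$ for all $i\le l\le j-1$. A Fubini ranking is flattened (respectively, weakly flattened) with runs of weak ascents if the leading (first) terms of its runs of weak ascents, read from left to right, are in strictly increasing (respectively, weakly increasing) order. *)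

theory Defs
  imports Complex_Main
begin

text \<open>
  A tuple $(r_1,\ldots,r_n)$ is represented by a list of length $n$; list positions are numbered
  from 0, so the entry $r_i$ is \<open>r ! (i - 1)\<close>.
\<close>

text \<open>A competitor's rank is one plus the number of competitors ranked strictly ahead of it.\<close>

definition fubini_ranking :: "nat list \<Rightarrow> bool" where
  "fubini_ranking r \<longleftrightarrow>
     set r \<subseteq> {1..length r} \<and>
     (\<forall>i<length r. r ! i = 1 + card {j. j < length r \<and> r ! j < r ! i})"

text \<open>The contiguous subword occupying positions \<open>i\<close> to \<open>j\<close>, both included, is weakly ascending.\<close>

definition weakly_ascending_on :: "nat list \<Rightarrow> nat \<Rightarrow> nat \<Rightarrow> bool" where
  "weakly_ascending_on w i j \<longleftrightarrow>
     i \<le> j \<and> j < length w \<and> (\<forall>l. i \<le> l \<and> l < j \<longrightarrow> w ! l \<le> w ! Suc l)"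

text \<open>
  A run is identified by its pair of first and last positions, so that equal subwords at
  different positions count as different runs.
\<close>

definition weak_ascent_runs :: "nat list \<Rightarrow> (nat \<times> nat) set" where
  "weak_ascent_runs w =
     {(i, j). weakly_ascending_on w i j \<and>
        (\<forall>i' j'. weakly_ascending_on w i' j' \<and> i' \<le> i \<and> j \<le> j' \<longrightarrow> i' = i \<and> j' = j)}"

definition leading_terms :: "nat list \<Rightarrow> nat list" where
  "leading_terms w = map (\<lambda>i. w ! i) (sorted_list_of_set (fst ` weak_ascent_runs w))"

definition flattened :: "nat list \<Rightarrow> bool" where
  "flattened w \<longleftrightarrow> sorted_wrt (<) (leading_terms w)"

definition weakly_flattened :: "nat list \<Rightarrow> bool" where
  "weakly_flattened w \<longleftrightarrow> sorted_wrt (\<le>) (leading_terms w)"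

definition W :: "nat \<Rightarrow> nat \<Rightarrow> nat" where
  "W j k = card {r. length r = j \<and> fubini_ranking r \<and> weakly_flattened r \<and>
                    card (weak_ascent_runs r) = k}"

definition S :: "nat \<Rightarrow> nat \<Rightarrow> nat" where
  "S j k = card {r. length r = j \<and> fubini_ranking r \<and> flattened r \<and>
                    card (weak_ascent_runs r) = k}"

text \<open>
  The sets involved are finite, so neither \<open>card\<close> nor \<open>sorted_list_of_set\<close> takes its default value.
\<close>

lemma finite_fubini_rankings: "finite {r. length r = n \<and> fubini_ranking r}"
proof (rule finite_subset)
  show "{r. length r = n \<and> fubini_ranking r} \<subseteq> {r. set r \<subseteq> {1..n} \<and> length r = n}"
    by (auto simp: fubini_ranking_def)
qed (simp add: finite_lists_length_eq)

lemma finite_weak_ascent_runs: "finite (weak_ascent_runs w)"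
proof (rule finite_subset)
  show "weak_ascent_runs w \<subseteq> {..<length w} \<times> {..<length w}"
    by (auto simp: weak_ascent_runs_def weakly_ascending_on_def)
qed simp

end

theory Submission
  imports Defs
begin

text \<open>
  Runs of weak ascents are determined by their first positions, and these are position 0 together
  with the positions just after a descent (\<open>card_weak_ascent_runs\<close>). If two neighbouring positions
  both started runs, the leading term of the second run would be smaller than that of the first.
  Hence in a weakly flattened word of length \<open>n\<close> no two run starts are adjacent, and
  there are at most \<open>\<lceil>n / 2\<rceil>\<close> of them (\<open>weakly_flattened_card_runs_le\<close>).

  Conversely, for \<open>2 m < n\<close> the permutation \<open>1, 3, 2, 5, 4, \<dots>, 2 m + 1, 2 m, 2 m + 2, \<dots>, n\<close>
  has the runs \<open>1 3 | 2 5 | 4 7 | \<dots> | 2 m, 2 m + 2, \<dots>, n\<close>, which are \<open>m + 1\<close> in number and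
  start with \<open>1 < 2 < 4 < \<dots> < 2 m\<close>. It is a Fubini ranking because every permutation is, and so
  every number of runs from 1 to \<open>\<lceil>n / 2\<rceil>\<close> already occurs in the strictly flattened case.
\<close>

definition run_starts :: "nat list \<Rightarrow> nat set" where
  "run_starts w = {i. i < length w \<and> (i = 0 \<or> w ! i < w ! (i - 1))}"

lemma finite_run_starts: "finite (run_starts w)"
  unfolding run_starts_def by simp

lemma fst_weak_ascent_runs: "fst ` weak_ascent_runs w = run_starts w"
proof (intro equalityI subsetI)
  fix i assume "i \<in> fst ` weak_ascent_runs w"
  then obtain j where asc: "weakly_ascending_on w i j"
    and max: "\<And>i' j'. weakly_ascending_on w i' j' \<Longrightarrow> i' \<le> i \<Longrightarrow> j \<le> j' \<Longrightarrow> i' = i \<and> j' = j"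
    by (auto simp: weak_ascent_runs_def)
  have "w ! i < w ! (i - 1)" if "i \<noteq> 0"
  proof (rule ccontr)
    assume "\<not> w ! i < w ! (i - 1)"
    \<comment> \<open>The run could then be prolonged to the left.\<close>
    have "w ! l \<le> w ! Suc l" if "i - 1 \<le> l" "l < j" for l
    proof (cases "l = i - 1")
      case True
      then show ?thesis using \<open>i \<noteq> 0\<close> \<open>\<not> w ! i < w ! (i - 1)\<close> by simp
    next
      case False
      then show ?thesis using that asc by (simp add: weakly_ascending_on_def)
    qed
    then have "weakly_ascending_on w (i - 1) j"
      using asc by (auto simp: weakly_ascending_on_def)
    then show False using max[of "i - 1" j] that by simp
  qed
  then show "i \<in> run_starts w"
    using asc by (auto simp: run_starts_def weakly_ascending_on_def)
next
  fix i assume i: "i \<in> run_starts w"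
  \<comment> \<open>The longest ascending subword from \<open>i\<close> on is a run: it cannot be prolonged past the descent
    on its left.\<close>
  define J where "J = {j. weakly_ascending_on w i j}"
  have fin: "finite J"
    by (rule finite_subset[of _ "{..<length w}"]) (auto simp: J_def weakly_ascending_on_def)
  have "i \<in> J"
    using i by (auto simp: J_def weakly_ascending_on_def run_starts_def)
  then have "Max J \<in> J" using fin by (metis Max_in empty_iff)
  have "i' = i \<and> j' = Max J"
    if "weakly_ascending_on w i' j'" "i' \<le> i" "Max J \<le> j'" for i' j'
  proof -
    have "i \<le> Max J" using fin \<open>i \<in> J\<close> by simp
    have "i' = i"
    proof (rule ccontr)
      assume "i' \<noteq> i"
      then have "i' \<le> i - 1" "i - 1 < j'" "i \<noteq> 0"
        using that \<open>i \<le> Max J\<close> by linarith+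
      then have "w ! (i - 1) \<le> w ! Suc (i - 1)"
        using that(1) by (simp only: weakly_ascending_on_def)
      then show False using i \<open>i \<noteq> 0\<close> by (simp add: run_starts_def)
    qed
    then have "j' \<in> J" using that by (simp add: J_def)
    then have "j' \<le> Max J" using fin by simp
    then show ?thesis using \<open>i' = i\<close> that by simp
  qed
  then have "(i, Max J) \<in> weak_ascent_runs w"
    using \<open>Max J \<in> J\<close> by (auto simp: weak_ascent_runs_def J_def)
  then show "i \<in> fst ` weak_ascent_runs w" by force
qed

text \<open>Of two runs with the same first position, the longer one contains the other.\<close>

lemma inj_on_fst_weak_ascent_runs: "inj_on fst (weak_ascent_runs w)"
proof (rule inj_onI)
  fix x y
  assume "x \<in> weak_ascent_runs w" "y \<in> weak_ascent_runs w" "fst x = fst y"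
  then show "x = y"
    using nle_le[of "snd x" "snd y"]
    by (cases x; cases y) (auto simp: weak_ascent_runs_def)
qed

lemma card_weak_ascent_runs: "card (weak_ascent_runs w) = card (run_starts w)"
  using card_image[OF inj_on_fst_weak_ascent_runs[of w]] by (simp add: fst_weak_ascent_runs)

lemma sorted_wrt_map_strict_sorted:
  fixes xs :: "'a::linorder list"
  assumes "sorted_wrt (<) xs"
  shows "sorted_wrt R (map f xs) \<longleftrightarrow> (\<forall>x\<in>set xs. \<forall>y\<in>set xs. x < y \<longrightarrow> R (f x) (f y))"
  using assms by (induction xs) auto

lemma sorted_wrt_leading_terms:
  "sorted_wrt R (leading_terms w) \<longleftrightarrow>
     (\<forall>a\<in>run_starts w. \<forall>b\<in>run_starts w. a < b \<longrightarrow> R (w ! a) (w ! b))"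
  by (simp add: leading_terms_def fst_weak_ascent_runs sorted_wrt_map_strict_sorted
      finite_run_starts)

lemma flattened_imp_weakly_flattened: "flattened w \<Longrightarrow> weakly_flattened w"
  unfolding flattened_def weakly_flattened_def
  by (erule sorted_wrt_mono_rel[rotated]) simp

text \<open>
  Grouping the positions into the blocks \<open>{0, 1}, {2, 3}, \<dots>\<close>, each block holds at most one
  element of \<open>A\<close>.
\<close>

lemma card_no_two_adjacent_le:
  fixes A :: "nat set"
  assumes "A \<subseteq> {..<n}" and "\<And>i. i \<in> A \<Longrightarrow> Suc i \<notin> A"
  shows "card A \<le> (n + 1) div 2"
proof -
  have "inj_on (\<lambda>i. i div 2) A"
  proof (rule inj_onI)
    fix x y assume "x \<in> A" "y \<in> A" "x div 2 = y div 2"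
    moreover from this have "x = y \<or> x = Suc y \<or> y = Suc x" by presburger
    ultimately show "x = y" using assms(2) by blast
  qed
  moreover have "(\<lambda>i. i div 2) ` A \<subseteq> {..<(n + 1) div 2}"
    using assms(1) by force
  ultimately have "card A \<le> card {..<(n + 1) div 2}"
    by (intro card_inj_on_le[of "\<lambda>i. i div 2"]) auto
  then show ?thesis by simp
qed

lemma weakly_flattened_card_runs_le:
  assumes "weakly_flattened w"
  shows "card (weak_ascent_runs w) \<le> (length w + 1) div 2"
  unfolding card_weak_ascent_runs
proof (rule card_no_two_adjacent_le)
  show "run_starts w \<subseteq> {..<length w}" by (auto simp: run_starts_def)
next
  fix i assume "i \<in> run_starts w"
  show "Suc i \<notin> run_starts w"
  proof
    assume "Suc i \<in> run_starts w"
    then have "w ! i \<le> w ! Suc i"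
      using assms \<open>i \<in> run_starts w\<close>
      by (simp add: weakly_flattened_def sorted_wrt_leading_terms)
    then show False using \<open>Suc i \<in> run_starts w\<close> by (simp add: run_starts_def)
  qed
qed

text \<open>
  In a permutation of \<open>1, \<dots>, n\<close> the entries below \<open>v\<close> are \<open>1, \<dots>, v - 1\<close>, each occurring once.
\<close>

lemma fubini_ranking_permutation:
  assumes "distinct r" and "set r = {1..length r}"
  shows "fubini_ranking r"
  unfolding fubini_ranking_def
proof (intro conjI allI impI)
  show "set r \<subseteq> {1..length r}" using assms(2) by simp
next
  fix i assume i: "i < length r"
  have v: "r ! i \<in> {1..length r}" using assms(2) i nth_mem by blast
  let ?J = "{j. j < length r \<and> r ! j < r ! i}"
  have "inj_on ((!) r) ?J" using assms(1) by (auto intro: inj_on_nth)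
  moreover have "(!) r ` ?J = {x \<in> set r. x < r ! i}" by (auto simp: in_set_conv_nth)
  moreover have "{x \<in> set r. x < r ! i} = {1..<r ! i}" using assms(2) v by auto
  ultimately have "card ?J = card {1..<r ! i}" by (metis card_image)
  then show "r ! i = 1 + card ?J" using v by simp
qed

text \<open>
  The word \<open>1, 3, 2, 5, 4, \<dots>, 2 m + 1, 2 m, 2 m + 2, \<dots>, n\<close>: the identity permutation with the
  entries \<open>2 i\<close> and \<open>2 i + 1\<close> exchanged for \<open>i = 1, \<dots>, m\<close>. Positions count from 0, so this pair
  sits at positions \<open>2 i - 1\<close> and \<open>2 i\<close>.
\<close>

definition zigzag_entry :: "nat \<Rightarrow> nat \<Rightarrow> nat" where
  "zigzag_entry m p =
     (if odd p \<and> p < 2 * m then p + 2 else if even p \<and> 0 < p \<and> p \<le> 2 * m then p else p + 1)"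

definition zigzag :: "nat \<Rightarrow> nat \<Rightarrow> nat list" where
  "zigzag m n = map (zigzag_entry m) [0..<n]"

lemma length_zigzag [simp]: "length (zigzag m n) = n"
  by (simp add: zigzag_def)

lemma nth_zigzag [simp]: "p < n \<Longrightarrow> zigzag m n ! p = zigzag_entry m p"
  by (simp add: zigzag_def)

lemma inj_zigzag_entry: "inj (zigzag_entry m)"
proof (rule injI)
  fix p q assume "zigzag_entry m p = zigzag_entry m q"
  then show "p = q" unfolding zigzag_entry_def by (auto split: if_splits; presburger)
qed

lemma fubini_ranking_zigzag:
  assumes "2 * m < n"
  shows "fubini_ranking (zigzag m n)"
proof (rule fubini_ranking_permutation)
  show dist: "distinct (zigzag m n)"
    using inj_zigzag_entry by (auto simp: zigzag_def distinct_map intro: inj_on_subset)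
  have "zigzag_entry m p \<in> {1..n}" if "p < n" for p
    using that assms by (auto simp: zigzag_entry_def)
  then have "set (zigzag m n) \<subseteq> {1..n}" by (auto simp: zigzag_def)
  moreover have "card (set (zigzag m n)) = n" using dist by (simp add: distinct_card)
  ultimately show "set (zigzag m n) = {1..length (zigzag m n)}"
    by (intro card_subset_eq) auto
qed

lemma run_starts_zigzag:
  assumes "2 * m < n"
  shows "run_starts (zigzag m n) = (\<lambda>i. 2 * i) ` {..m}"
proof -
  have "p \<in> run_starts (zigzag m n) \<longleftrightarrow> even p \<and> p \<le> 2 * m" for p
    using assms by (cases p) (auto simp: run_starts_def zigzag_entry_def split: if_splits)
  then show ?thesis by (fastforce elim!: evenE)
qed

lemma card_runs_zigzag:
  "2 * m < n \<Longrightarrow> card (weak_ascent_runs (zigzag m n)) = m + 1"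
  by (simp add: card_weak_ascent_runs run_starts_zigzag card_image inj_on_def)

lemma flattened_zigzag: "2 * m < n \<Longrightarrow> flattened (zigzag m n)"
  by (auto simp: flattened_def sorted_wrt_leading_terms run_starts_zigzag zigzag_entry_def)

lemma W_eq_0_iff:
  "W j k = 0 \<longleftrightarrow>
     \<not> (\<exists>r. length r = j \<and> fubini_ranking r \<and> weakly_flattened r \<and> card (weak_ascent_runs r) = k)"
proof -
  have "finite {r. length r = j \<and> fubini_ranking r \<and> weakly_flattened r \<and>
      card (weak_ascent_runs r) = k}"
    by (rule finite_subset[OF _ finite_fubini_rankings[of j]]) auto
  then show ?thesis by (auto simp: W_def)
qed

lemma S_eq_0_iff:
  "S j k = 0 \<longleftrightarrow>
     \<not> (\<exists>r. length r = j \<and> fubini_ranking r \<and> flattened r \<and> card (weak_ascent_runs r) = k)"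
proof -
  have "finite {r. length r = j \<and> fubini_ranking r \<and> flattened r \<and>
      card (weak_ascent_runs r) = k}"
    by (rule finite_subset[OF _ finite_fubini_rankings[of j]]) auto
  then show ?thesis by (auto simp: S_def)
qed

theorem theorem3p10:
  fixes j k :: nat
  assumes "j \<ge> 1" and "k \<ge> 1"
  shows "(W j k = 0 \<longleftrightarrow> int k > \<lceil>real j / 2\<rceil>) \<and> (S j k = 0 \<longleftrightarrow> int k > \<lceil>real j / 2\<rceil>)"
proof -
  have ceil: "int k > \<lceil>real j / 2\<rceil> \<longleftrightarrow> k > (j + 1) div 2"
  proof -
    have "int k > \<lceil>real j / 2\<rceil> \<longleftrightarrow> real j / 2 \<le> real k - 1"
      by (simp add: less_ceiling_iff ceiling_less_iff)
    also have "\<dots> \<longleftrightarrow> j + 2 \<le> 2 * k" by linarith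
    also have "\<dots> \<longleftrightarrow> k > (j + 1) div 2" by presburger
    finally show ?thesis .
  qed
  have upper: "W j k = 0" if "k > (j + 1) div 2"
    using that weakly_flattened_card_runs_le by (fastforce simp: W_eq_0_iff)
  have lower: "S j k \<noteq> 0" if "\<not> k > (j + 1) div 2"
  proof -
    have "2 * (k - 1) < j" using that assms by presburger
    then show ?thesis
      using assms fubini_ranking_zigzag flattened_zigzag card_runs_zigzag[of "k - 1" j]
      by (auto simp: S_eq_0_iff intro!: exI[of _ "zigzag (k - 1) j"])
  qed
  have "S j k = 0" if "W j k = 0"
    using that flattened_imp_weakly_flattened by (auto simp: W_eq_0_iff S_eq_0_iff)
  then show ?thesis using ceil upper lower by metis
qed

end
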